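(* Let $0<\lambda<1$ and $0<q\le 1$. In the discrete-time framework, the definition of the fractional Poisson process as a renewal process and the definition by subordination (with the Sibuya distribution with parameter $q$ playing the role corresponding to the subordinator of the continuous model) bifurcate into different probabilistic models, in contrast with the continuous-time fractional Poisson process, for which the definition as a renewal process is known to be strictly equivalent to the one obtained by subordinating a standard Poisson process with an inverse stable process. More precisely: let $G_1(z)=\frac{\lambda z}{1-z+\lambda}$ be the probability generating function (PGF) of the waiting time of the standard discrete Poisson process (the case $q=1$), and let $S_q(z)=1-(1-z)^q$ be the PGF of the Sibuya distribution with parameter $q$. Applying subordination with the Sibuya distribution, the PGF of the new waiting time is the composite function $$G_{sub}(z)=G_1(S_q(z))=\frac{\lambda\,(1-(1-z)^q)}{(1-z)^q+\lambda}.$$ Compare this with the PGF of the waiting time $T_1^q$ of the renewal-type discrete fractional Poisson process, $$G^q(z)=E[z^{T_1^q}]=\frac{\lambda z}{(1-z)^q+\lambda}.$$ The two share the identical denominator $(1-z)^q+\lambda$, which implies that both models share macroscopic fractional characteristics, such as the divergence of the expected value of the waiting time distribution. However, the structure of the numerators, $1-(1-z)^q$ and $z$, is distinctly different, so the two models strictly follow different probabilistic laws on the microscopic discrete steps.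
   Context: For $x\in\mathbb{R}\setminus\{0,-1,-2,\dots\}$ and $\alpha\in\mathbb{R}\setminus\{-1,-2,\dots\}$ with $x+\alpha\notin\{0,-1,-2,\dots\}$, put $$\hat h_\alpha(x)=\frac{\Gamma(x+\alpha)}{\Gamma(\alpha+1)\,\Gamma(x)}.$$ For real $q>0$ the discrete Mittag-Leffler function is $F_{q,\lambda}(t)=\sum_{m=0}^\infty \hat h_{qm}(t)\,\lambda^m$. Renewal-type discrete fractional Poisson process: for $0<\lambda<1$ and $0<q\le1$, let $T_1^q,T_2^q,\dots$ be i.i.d. random variables supported on $\{1,2,\dots\}$ with $P(T_i^q>t)=F_{q,-\lambda}(t)$ for $t=1,2,\dots$ (discrete Mittag-Leffler distribution). Let $S_0^q=0$, $S_n^q=T_1^q+\dots+T_n^q$, and $N^q(t)=\max\{n\ge0: S_n^q\le t\}$. The standard discrete Poisson process is the case $q=1$. Sibuya distribution: a random variable $X$ follows the Sibuya distribution with parameter $q\in(0,1)$ if $P(X=k)=(-1)^{k-1}\binom{q}{k}$ for $k=1,2,3,\dots$, where $\binom{q}{k}=\frac{q(q-1)\cdots(q-k+1)}{k!}$. Its PGF is $S_q(z)=1-(1-z)^q$.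
   Formalization: Divergence of the expected waiting times and difference of the numerators and laws are claimed only for q<1: at q=1 both PGFs equal λz/(1-z+λ), with finite mean (1+λ)/λ, so these claims fail there. The PGF formulas are kept for 0<q≤1. *)

theory Defs
  imports "HOL-Probability.Probability"
begin

definition frac_h :: "real \<Rightarrow> real \<Rightarrow> real" where
  "frac_h a x = Gamma (x + a) / (Gamma (a + 1) * Gamma x)"

definition discrete_mittag_leffler :: "real \<Rightarrow> real \<Rightarrow> real \<Rightarrow> real" where
  "discrete_mittag_leffler q lam t = (\<Sum>m. frac_h (q * real m) t * lam ^ m)"

definition pgf :: "'a measure \<Rightarrow> ('a \<Rightarrow> nat) \<Rightarrow> real \<Rightarrow> real" where
  "pgf M X z = (\<integral>\<omega>. z ^ X \<omega> \<partial>M)"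

definition mittag_leffler_distributed :: "'a measure \<Rightarrow> real \<Rightarrow> real \<Rightarrow> ('a \<Rightarrow> nat) \<Rightarrow> bool" where
  "mittag_leffler_distributed M q lam X \<longleftrightarrow>
     X \<in> measurable M (count_space UNIV) \<and>
     (AE \<omega> in M. 1 \<le> X \<omega>) \<and>
     (\<forall>t\<ge>1. measure M {\<omega> \<in> space M. t < X \<omega>} = discrete_mittag_leffler q (- lam) (real t))"

text \<open>For \<open>q = 1\<close> the same formula gives the point mass at \<open>1\<close>.\<close>

definition sibuya_distributed :: "'a measure \<Rightarrow> real \<Rightarrow> ('a \<Rightarrow> nat) \<Rightarrow> bool" where
  "sibuya_distributed M q X \<longleftrightarrow>
     X \<in> measurable M (count_space UNIV) \<and>
     (AE \<omega> in M. 1 \<le> X \<omega>) \<and>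
     (\<forall>k\<ge>1. measure M {\<omega> \<in> space M. X \<omega> = k} = (-1) ^ (k - 1) * (q gchoose k))"

text \<open>Sequences are indexed from \<open>1\<close>; the value at index \<open>0\<close> is never used. The set below is finite
  whenever all but finitely many steps are positive, so almost surely in every use.\<close>

definition renewal_count :: "(nat \<Rightarrow> 'a \<Rightarrow> nat) \<Rightarrow> nat \<Rightarrow> 'a \<Rightarrow> nat" where
  "renewal_count T t \<omega> = Max {n. (\<Sum>i = 1..n. T i \<omega>) \<le> t}"

definition renewal_poisson_model ::
  "'a measure \<Rightarrow> real \<Rightarrow> real \<Rightarrow> (nat \<Rightarrow> 'a \<Rightarrow> nat) \<Rightarrow> bool" where
  "renewal_poisson_model M q lam T \<longleftrightarrow>
     prob_space M \<and>
     prob_space.indep_vars M (\<lambda>_. count_space UNIV) T {1..} \<and>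
     (\<forall>i\<ge>1. mittag_leffler_distributed M q lam (T i))"

text \<open>The waiting times \<open>T\<close> of a standard process (\<open>q = 1\<close>) and the steps \<open>X\<close> of a Sibuya random
  walk, all of them jointly independent.\<close>

definition subordination_model ::
  "'a measure \<Rightarrow> real \<Rightarrow> real \<Rightarrow> (nat \<Rightarrow> 'a \<Rightarrow> nat) \<Rightarrow> (nat \<Rightarrow> 'a \<Rightarrow> nat) \<Rightarrow> bool" where
  "subordination_model M q lam T X \<longleftrightarrow>
     prob_space M \<and>
     prob_space.indep_vars M (\<lambda>_. count_space UNIV) (case_sum T X) ({1..} <+> {1..}) \<and>
     (\<forall>i\<ge>1. mittag_leffler_distributed M 1 lam (T i)) \<and>
     (\<forall>i\<ge>1. sibuya_distributed M q (X i))"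

text \<open>As in continuous time, the standard process is evaluated at the inverse of the subordinator:
  \<open>renewal_count X t\<close> is the number of steps the walk \<open>X\<^sub>1 + X\<^sub>2 + \<dots>\<close> completes up to time \<open>t\<close>.\<close>

definition subordinated_count ::
  "(nat \<Rightarrow> 'a \<Rightarrow> nat) \<Rightarrow> (nat \<Rightarrow> 'a \<Rightarrow> nat) \<Rightarrow> nat \<Rightarrow> 'a \<Rightarrow> nat" where
  "subordinated_count T X t \<omega> = renewal_count T (renewal_count X t \<omega>) \<omega>"

definition arrival_time :: "(nat \<Rightarrow> 'a \<Rightarrow> nat) \<Rightarrow> nat \<Rightarrow> 'a \<Rightarrow> nat" where
  "arrival_time N n \<omega> = (LEAST t. n \<le> N t \<omega>)"

definition waiting_time :: "(nat \<Rightarrow> 'a \<Rightarrow> nat) \<Rightarrow> nat \<Rightarrow> 'a \<Rightarrow> nat" where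
  "waiting_time N n \<omega> = arrival_time N n \<omega> - arrival_time N (n - 1) \<omega>"

end

theory Submission
  imports Defs
begin

text \<open>For small \<open>\<bar>z\<bar>\<close> the tail generating function \<open>\<Sum>\<^sub>t P(T > t) z\<^sup>t\<close> of a Mittag-Leffler waiting time is
  a double series; summing over \<open>t\<close> first gives binomial series \<open>(1 - z)\<close> to the power \<open>-(qm + 1)\<close>, then a
  geometric series in \<open>m\<close>. The resulting formula for the generating function spreads to the closed
  interval by uniqueness of power series coefficients and by continuity. In the subordinated model the
  \<open>n\<close>-th arrival is the walk \<open>X\<close> stopped at the \<open>n\<close>-th arrival of the standard process, so a waiting time
  is a sum of \<open>T'\<^sub>n\<close> independent Sibuya steps and its generating function is a composition. Both
  functions satisfy \<open>1 - G(z) \<ge> c (1 - z)\<^sup>q\<close>, which no finite mean allows when \<open>q < 1\<close>.\<close>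

section \<open>Generating functions of natural-valued random variables\<close>

text \<open>Once the lower coefficients vanish, dividing by \<open>x ^ n\<close> leaves a series
  with constant term \<open>a n\<close>; its limit at 0 is both \<open>a n\<close> and 0.\<close>

lemma powser_eq_0_near_0_imp_coeff_eq_0:
  fixes a :: "nat \<Rightarrow> real"
  assumes s: "0 < s" and sm: "\<And>x. x \<noteq> 0 \<Longrightarrow> norm x < s \<Longrightarrow> (\<lambda>n. a n * x ^ n) sums 0"
  shows "a n = 0"
proof (induction n rule: less_induct)
  case (less n)
  have "(\<lambda>k. a (k + n) * x ^ k) sums 0" if x: "x \<noteq> 0" "norm x < s" for x
  proof -
    have "(\<lambda>k. a (k + n) * x ^ (k + n)) sums (0 - (\<Sum>i<n. a i * x ^ i))"
      using sums_split_initial_segment[OF sm[OF x], of n] .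
    then have "(\<lambda>k. a (k + n) * x ^ (k + n)) sums 0"
      using less by simp
    then have "(\<lambda>k. a (k + n) * x ^ (k + n) / x ^ n) sums (0 / x ^ n)"
      by (rule sums_divide)
    then show ?thesis
      using x by (simp add: power_add)
  qed
  then have "((\<lambda>_. 0) \<longlongrightarrow> a (0 + n)) (at (0::real))"
    by (rule powser_limit_0_strong[OF s])
  then show ?case
    by (simp add: tendsto_const_iff)
qed

text \<open>The space splits into countably many pieces by the value of \<open>Y\<close>, and each
  partial sum is \<open>f\<close> or 0, so the constant 1 dominates. Taking \<open>Y\<close> to be
  the variable itself gives PGF coefficients; taking a coded pair gives the conditioning in
  \<open>pgf_W\<close>.\<close>

lemma (in prob_space) expectation_sums_over_value:
  fixes f :: "'a \<Rightarrow> real" and Y :: "'a \<Rightarrow> nat"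
  assumes [measurable]: "f \<in> borel_measurable M" "Y \<in> measurable M (count_space UNIV)"
    and bound: "\<And>\<omega>. \<bar>f \<omega>\<bar> \<le> 1"
  shows "(\<lambda>c. \<integral>\<omega>. indicator {\<omega>\<in>space M. Y \<omega> = c} \<omega> * f \<omega> \<partial>M) sums (\<integral>\<omega>. f \<omega> \<partial>M)"
proof -
  have ind: "(\<lambda>c. indicator {\<omega>\<in>space M. Y \<omega> = c} \<omega> * f \<omega>) sums f \<omega>" if "\<omega> \<in> space M" for \<omega>
  proof -
    have "(\<lambda>c. indicator {\<omega>\<in>space M. Y \<omega> = c} \<omega> * f \<omega>) sums (\<Sum>c\<in>{Y \<omega>}. indicator {\<omega>\<in>space M. Y \<omega> = c} \<omega> * f \<omega>)"
      by (rule sums_finite) (auto split: split_indicator)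
    then show ?thesis
      using that by simp
  qed
  have part: "(\<lambda>n. \<integral>\<omega>. (\<Sum>c<n. indicator {\<omega>\<in>space M. Y \<omega> = c} \<omega> * f \<omega>) \<partial>M) \<longlonglongrightarrow> (\<integral>\<omega>. f \<omega> \<partial>M)"
  proof (rule integral_dominated_convergence[where w="\<lambda>_. 1"])
    show "AE \<omega> in M. (\<lambda>n. \<Sum>c<n. indicator {\<omega>\<in>space M. Y \<omega> = c} \<omega> * f \<omega>) \<longlonglongrightarrow> f \<omega>"
      using ind by (auto simp: sums_def)
    have "norm (\<Sum>c<n. indicator {\<omega>\<in>space M. Y \<omega> = c} \<omega> * f \<omega>) \<le> 1" if "\<omega> \<in> space M" for \<omega> n
    proof -
      have "(\<Sum>c<n. indicator {\<omega>\<in>space M. Y \<omega> = c} \<omega> * f \<omega>) = (\<Sum>c<n. if Y \<omega> = c then f \<omega> else 0)"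
        using that by (intro sum.cong) auto
      then show ?thesis
        using bound[of \<omega>] by (simp add: sum.delta)
    qed
    then show "AE \<omega> in M. norm (\<Sum>c<n. indicator {\<omega>\<in>space M. Y \<omega> = c} \<omega> * f \<omega>) \<le> 1" for n
      by auto
  qed auto
  have "integrable M (\<lambda>\<omega>. indicator {\<omega>\<in>space M. Y \<omega> = c} \<omega> * f \<omega>)" for c
    by (rule integrable_const_bound[where B=1]) (use bound in \<open>auto split: split_indicator\<close>)
  then have "(\<integral>\<omega>. (\<Sum>c<n. indicator {\<omega>\<in>space M. Y \<omega> = c} \<omega> * f \<omega>) \<partial>M)
      = (\<Sum>c<n. \<integral>\<omega>. indicator {\<omega>\<in>space M. Y \<omega> = c} \<omega> * f \<omega> \<partial>M)" for n
    by (intro Bochner_Integration.integral_sum)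
  with part show ?thesis
    by (simp only: sums_def)
qed

lemma abs_power_le_1:
  fixes z :: real
  assumes "\<bar>z\<bar> \<le> 1"
  shows "\<bar>z ^ n\<bar> \<le> 1"
  using assms by (simp add: power_abs power_le_one)

lemma (in prob_space) pgf_sums:
  assumes [measurable]: "X \<in> measurable M (count_space UNIV)" and z: "\<bar>z\<bar> \<le> 1"
  shows "(\<lambda>k. prob {\<omega>\<in>space M. X \<omega> = k} * z ^ k) sums pgf M X z"
proof -
  have "(\<lambda>k. \<integral>\<omega>. indicator {\<omega>\<in>space M. X \<omega> = k} \<omega> * z ^ X \<omega> \<partial>M) sums pgf M X z"
    unfolding pgf_def by (intro expectation_sums_over_value abs_power_le_1 z) auto
  moreover have "(\<integral>\<omega>. indicator {\<omega>\<in>space M. X \<omega> = k} \<omega> * z ^ X \<omega> \<partial>M)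
      = (\<integral>\<omega>. indicator {\<omega>\<in>space M. X \<omega> = k} \<omega> * z ^ k \<partial>M)" for k
    by (rule Bochner_Integration.integral_cong) (auto split: split_indicator)
  ultimately show ?thesis
    by simp
qed

lemma (in prob_space) abs_pgf_le_1:
  assumes [measurable]: "X \<in> measurable M (count_space UNIV)" and z: "\<bar>z\<bar> \<le> 1"
  shows "\<bar>pgf M X z\<bar> \<le> 1"
proof -
  have *: "integrable M (\<lambda>\<omega>. z ^ X \<omega>)"
    by (rule integrable_const_bound[where B=1]) (use abs_power_le_1[OF z] in auto)
  have "\<bar>pgf M X z\<bar> \<le> (\<integral>\<omega>. \<bar>z ^ X \<omega>\<bar> \<partial>M)"
    unfolding pgf_def by (rule integral_abs_bound)
  also have "\<dots> \<le> 1"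
    by (rule integral_le_const) (use * abs_power_le_1[OF z] in auto)
  finally show ?thesis .
qed

lemma (in prob_space) continuous_on_pgf:
  assumes [measurable]: "X \<in> measurable M (count_space UNIV)"
  shows "continuous_on {-1..1} (pgf M X)"
  unfolding continuous_on_sequentially
proof safe
  fix u a assume a: "a \<in> {-1..1::real}" and u: "\<forall>n. u n \<in> {-1..1}" "u \<longlonglongrightarrow> a"
  show "(pgf M X \<circ> u) \<longlonglongrightarrow> pgf M X a"
    unfolding pgf_def comp_def
  proof (rule integral_dominated_convergence[where w="\<lambda>_. 1"])
    show "AE \<omega> in M. (\<lambda>n. u n ^ X \<omega>) \<longlonglongrightarrow> a ^ X \<omega>"
      using u by (auto intro!: tendsto_intros)
    have "\<bar>u n\<bar> \<le> 1" for n
      using u(1)[rule_format, of n] by auto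
    then show "AE \<omega> in M. norm (u n ^ X \<omega>) \<le> 1" for n
      using abs_power_le_1 by auto
  qed auto
qed

text \<open>Series arguments reach only the open interval; continuity of both sides adds the end
  points -1 and 1.\<close>

lemma (in prob_space) pgf_eqI_interior:
  assumes X: "X \<in> measurable M (count_space UNIV)"
    and g: "continuous_on {-1..1} g"
    and eq: "\<And>z. \<bar>z\<bar> < 1 \<Longrightarrow> pgf M X z = g z"
    and z: "\<bar>z\<bar> \<le> 1"
  shows "pgf M X z = g z"
proof -
  have "pgf M X z - g z = 0"
  proof (rule continuous_constant_on_closure[where f="\<lambda>z. pgf M X z - g z" and x=z and S="{-1<..<1}"])
    show "continuous_on (closure {-1<..<1}) (\<lambda>z. pgf M X z - g z)"
      using continuous_on_pgf[OF X] g by (auto intro!: continuous_intros)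
  qed (use eq z in \<open>auto simp: abs_le_iff abs_less_iff\<close>)
  then show ?thesis by simp
qed

text \<open>Mittag-Leffler laws are given by their tails, and this links tails to the PGF.
  Pointwise, the sum of \<open>z ^ t\<close> over \<open>t < X\<close> is the geometric sum
  \<open>(1 - z ^ X) / (1 - z)\<close>; then expectations are taken.\<close>

lemma (in prob_space) pgf_tail_sums:
  assumes [measurable]: "X \<in> measurable M (count_space UNIV)" and z: "\<bar>z\<bar> < 1"
  shows "(\<lambda>t. prob {\<omega>\<in>space M. t < X \<omega>} * z ^ t) sums ((1 - pgf M X z) / (1 - z))"
proof -
  have [simp]: "{..<n} \<inter> {t. t < m} = {..<min n m}" for n m :: nat by auto
  have part: "(\<Sum>t<n. indicator {\<omega>\<in>space M. t < X \<omega>} \<omega> * z ^ t) = (1 - z ^ min n (X \<omega>)) / (1 - z)"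
    if "\<omega> \<in> space M" for n \<omega>
  proof -
    have "(\<Sum>t<n. indicator {\<omega>\<in>space M. t < X \<omega>} \<omega> * z ^ t) = (\<Sum>t<n. if t < X \<omega> then z ^ t else 0)"
      using that by (intro sum.cong) auto
    also have "\<dots> = (\<Sum>t<min n (X \<omega>). z ^ t)"
      by (simp add: sum.If_cases)
    also have "\<dots> = (1 - z ^ min n (X \<omega>)) / (1 - z)"
      using z by (subst sum_gp_strict) auto
    finally show ?thesis .
  qed
  \<comment> \<open>Cutting the sum at \<open>n\<close> replaces \<open>X\<close> by
    \<open>min n X\<close>, and the bound \<open>2 / (1 - z)\<close> is uniform in
    \<open>n\<close>.\<close>
  have "(\<lambda>n. \<integral>\<omega>. (1 - z ^ min n (X \<omega>)) / (1 - z) \<partial>M) \<longlonglongrightarrow> (\<integral>\<omega>. (1 - z ^ X \<omega>) / (1 - z) \<partial>M)"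
  proof (rule integral_dominated_convergence[where w="\<lambda>_. 2 / (1 - z)"])
    have "(\<lambda>n. (1 - z ^ min n (X \<omega>)) / (1 - z)) \<longlonglongrightarrow> (1 - z ^ X \<omega>) / (1 - z)" for \<omega>
      by (rule tendsto_eventually) (use eventually_ge_at_top[of "X \<omega>"] in eventually_elim, simp add: min_def)
    then show "AE \<omega> in M. (\<lambda>n. (1 - z ^ min n (X \<omega>)) / (1 - z)) \<longlonglongrightarrow> (1 - z ^ X \<omega>) / (1 - z)"
      by auto
    have "\<bar>1 - z ^ n\<bar> \<le> 2" for n
      using abs_power_le_1[of z n] z by linarith
    then show "AE \<omega> in M. norm ((1 - z ^ min n (X \<omega>)) / (1 - z)) \<le> 2 / (1 - z)" for n
      using z by (auto intro!: divide_right_mono)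
  qed auto
  also have "(\<integral>\<omega>. (1 - z ^ X \<omega>) / (1 - z) \<partial>M) = (1 - pgf M X z) / (1 - z)"
  proof -
    have "integrable M (\<lambda>\<omega>. z ^ X \<omega>)"
      by (rule integrable_const_bound[where B=1]) (use abs_power_le_1[of z] z in auto)
    then show ?thesis
      by (simp add: pgf_def prob_space)
  qed
  also have "(\<lambda>n. \<integral>\<omega>. (1 - z ^ min n (X \<omega>)) / (1 - z) \<partial>M)
      = (\<lambda>n. \<Sum>t<n. prob {\<omega>\<in>space M. t < X \<omega>} * z ^ t)"
  proof
    fix n
    have "(\<integral>\<omega>. (1 - z ^ min n (X \<omega>)) / (1 - z) \<partial>M)
        = (\<integral>\<omega>. (\<Sum>t<n. indicator {\<omega>\<in>space M. t < X \<omega>} \<omega> * z ^ t) \<partial>M)"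
      by (rule Bochner_Integration.integral_cong[OF refl part[symmetric]])
    also have "\<dots> = (\<Sum>t<n. \<integral>\<omega>. indicator {\<omega>\<in>space M. t < X \<omega>} \<omega> * z ^ t \<partial>M)"
      by (rule Bochner_Integration.integral_sum)
        (auto intro!: integrable_mult_left integrable_real_indicator simp: emeasure_eq_measure)
    finally show "(\<integral>\<omega>. (1 - z ^ min n (X \<omega>)) / (1 - z) \<partial>M)
      = (\<Sum>t<n. prob {\<omega>\<in>space M. t < X \<omega>} * z ^ t)" by simp
  qed
  finally show ?thesis
    by (simp add: sums_def)
qed

section \<open>Mittag-Leffler and Sibuya generating functions\<close>

lemma one_minus_powr_sums:
  fixes z :: real
  assumes "\<bar>z\<bar> < 1"
  shows "(\<lambda>n. (-1) ^ n * (a gchoose n) * z ^ n) sums (1 - z) powr a"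
proof -
  have "(\<lambda>n. (a gchoose n) * (- z) ^ n) sums (1 + - z) powr a"
    by (rule gen_binomial_real) (use assms in simp)
  moreover have "(a gchoose n) * (- z) ^ n = (-1) ^ n * (a gchoose n) * z ^ n" for n
    by (simp add: power_minus[of z])
  ultimately show ?thesis by simp
qed

lemma continuous_on_one_minus_powr:
  assumes "0 < q"
  shows "continuous_on {-1..1::real} (\<lambda>z. (1 - z) powr q)"
  using assms by (intro continuous_on_powr' continuous_intros) auto

text \<open>Convergence at the larger radius \<open>(1 + |z|) / 2\<close>, still below 1, becomes
  absolute at \<open>z\<close>; Cauchy products need this.\<close>

lemma summable_norm_sums_unit_disc:
  fixes a :: "nat \<Rightarrow> real"
  assumes sm: "\<And>z. \<bar>z\<bar> < 1 \<Longrightarrow> (\<lambda>n. a n * z ^ n) sums f z" and z: "\<bar>z\<bar> < 1"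
  shows "summable (\<lambda>n. norm (a n * z ^ n))"
proof (rule powser_insidea)
  show "summable (\<lambda>n. a n * ((1 + \<bar>z\<bar>) / 2) ^ n)"
    using sm[of "(1 + \<bar>z\<bar>) / 2"] z by (auto simp: sums_iff)
qed (use z in auto)

text \<open>The Sibuya weights are the negated coefficients of \<open>(1 - z) powr q\<close> without
  the constant term.\<close>

lemma sibuya_pgf:
  assumes M: "prob_space M" and X: "sibuya_distributed M q X" and q: "0 < q" and z: "\<bar>z\<bar> \<le> 1"
  shows "pgf M X z = 1 - (1 - z) powr q"
proof -
  interpret prob_space M by fact
  have [measurable]: "X \<in> measurable M (count_space UNIV)"
    and ae: "AE \<omega> in M. 1 \<le> X \<omega>"
    and P: "\<And>k. k \<ge> 1 \<Longrightarrow> prob {\<omega> \<in> space M. X \<omega> = k} = (-1) ^ (k - 1) * (q gchoose k)"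
    using X by (auto simp: sibuya_distributed_def)
  have "prob {\<omega> \<in> space M. X \<omega> = 0} = 0"
    by (rule prob_eq_0_AE) (use ae in auto)
  then have P': "prob {\<omega> \<in> space M. X \<omega> = k} = (if k = 0 then 1 else 0) - (-1) ^ k * (q gchoose k)" for k
    using P[of k] by (cases k) auto
  have int: "pgf M X z = 1 - (1 - z) powr q" if z: "\<bar>z\<bar> < 1" for z
  proof -
    have "(\<lambda>k. (if k = 0 then 1 else 0) * z ^ k - (-1) ^ k * (q gchoose k) * z ^ k) sums (1 - (1 - z) powr q)"
      using sums_single[of 0 "\<lambda>k. z ^ k"]
      by (intro sums_diff one_minus_powr_sums z) (simp add: if_distrib[of "\<lambda>c. c * _"] cong: if_cong)
    then have "(\<lambda>k. prob {\<omega> \<in> space M. X \<omega> = k} * z ^ k) sums (1 - (1 - z) powr q)"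
      by (simp add: P' left_diff_distrib)
    with pgf_sums[of X z] z show ?thesis
      by (auto dest: sums_unique2)
  qed
  show ?thesis
    by (rule pgf_eqI_interior[OF _ _ int z]) (auto intro!: continuous_intros continuous_on_one_minus_powr q)
qed

section \<open>The double series of the Mittag-Leffler tails\<close>

text \<open>The Gamma quotient is a rising factorial over a factorial, hence a coefficient of the
  binomial series with exponent \<open>-(a + 1)\<close>. The shift \<open>Suc t\<close> matches
  times from 1 with coefficients from 0.\<close>

lemma frac_h_eq:
  assumes "0 \<le> a"
  shows "frac_h a (real (Suc t)) = (-1) ^ t * (-(a + 1) gchoose t)"
proof -
  have "a + 1 \<notin> \<int>\<^sub>\<le>\<^sub>0"
    using assms by (auto elim!: nonpos_Ints_cases)
  then have "pochhammer (a + 1) t = Gamma (a + 1 + real t) / Gamma (a + 1)"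
    by (rule pochhammer_Gamma)
  moreover have "Gamma (real (Suc t)) = fact t"
    using Gamma_fact[of t, where ?'a=real] by (simp add: add.commute)
  moreover have "(-1) ^ t * ((-1) ^ t * x) = (x::real)" for x
    by (simp flip: mult.assoc power_mult_distrib)
  ultimately show ?thesis
    by (simp add: frac_h_def gbinomial_pochhammer add_ac)
qed

text \<open>Positivity makes the absolute values of the double series the same series at
  \<open>|z|\<close> and \<open>lam\<close>.\<close>

lemma frac_h_nonneg:
  assumes "0 \<le> a"
  shows "0 \<le> frac_h a (real (Suc t))"
  unfolding frac_h_def using assms
  by (intro divide_nonneg_nonneg mult_nonneg_nonneg less_imp_le[OF Gamma_real_pos]) auto

lemma frac_h_sums:
  assumes "0 \<le> a" "\<bar>z\<bar> < 1"
  shows "(\<lambda>t. frac_h a (real (Suc t)) * z ^ t) sums (1 - z) powr (-(a + 1))"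
  using one_minus_powr_sums[OF assms(2)] by (simp only: frac_h_eq[OF assms(1)])

text \<open>The bound on \<open>lam\<close> says that the geometric ratio
  \<open>lam / (1 - |z|) powr q\<close> of the series of absolute values is below 1; this permits
  exchanging the two sums.\<close>

lemma discrete_mittag_leffler_sums:
  fixes z :: real
  assumes q: "0 < q" and lam: "0 < lam" "lam < (1 - \<bar>z\<bar>) powr q" and z: "\<bar>z\<bar> < 1"
  shows "(\<lambda>t. discrete_mittag_leffler q (- lam) (real (Suc t)) * z ^ t)
           sums ((1 - z) powr q / ((1 - z) * ((1 - z) powr q + lam)))"
proof -
  define f where "f w l m t = frac_h (q * real m) (real (Suc t)) * l ^ m * w ^ t" for w l m t
  have row: "((\<lambda>t. f w l m t) has_sum ((1 - w) powr (-(q * real m + 1)) * l ^ m)) UNIV"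
    if w: "\<bar>w\<bar> < 1" for w l m
  proof (rule norm_summable_imp_has_sum)
    have s: "(\<lambda>t. frac_h (q * real m) (real (Suc t)) * x ^ t * k ^ m) sums ((1 - x) powr (-(q * real m + 1)) * k ^ m)"
      if "\<bar>x\<bar> < 1" for x k
      using q that by (intro sums_mult2 frac_h_sums) auto
    show "(\<lambda>t. f w l m t) sums ((1 - w) powr (-(q * real m + 1)) * l ^ m)"
      using s[OF w] by (simp add: f_def mult_ac)
    show "summable (\<lambda>t. norm (f w l m t))"
      using sums_summable[OF s[of "\<bar>w\<bar>" "\<bar>l\<bar>"]] w q frac_h_nonneg[of "q * real m"]
      by (simp add: f_def abs_mult power_abs mult_ac)
  qed
  have geo: "((\<lambda>m. (1 - w) powr (-(q * real m + 1)) * l ^ m) has_sum ((1 - w) powr q / ((1 - w) * ((1 - w) powr q - l)))) UNIV"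
    if w: "\<bar>w\<bar> < 1" "\<bar>l\<bar> < (1 - w) powr q" for w l
  proof -
    define u where "u = (1 - w) powr q"
    have u: "u > 0" "\<bar>l / u\<bar> < 1"
      using w by (auto simp: u_def)
    have eq: "(1 - w) powr (-(q * real m + 1)) * l ^ m = inverse (1 - w) * (l / u) ^ m" for m
    proof -
      have "(1 - w) powr (-(q * real m + 1)) = inverse ((1 - w) powr (q * real m + 1))"
        by (rule powr_minus)
      also have "\<dots> = inverse (u ^ m * (1 - w))"
        using w by (simp add: powr_add u_def powr_powr [symmetric] powr_realpow)
      finally show ?thesis
        by (simp add: field_simps power_divide)
    qed
    have "(\<lambda>m. inverse (1 - w) * (l / u) ^ m) sums (inverse (1 - w) * (1 / (1 - l / u)))"
      using u by (intro sums_mult geometric_sums) auto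
    moreover have "inverse (1 - w) * (1 / (1 - l / u)) = u / ((1 - w) * (u - l))"
      using u w by (simp add: field_simps)
    moreover have "summable (\<lambda>m. norm (inverse (1 - w) * (l / u) ^ m))"
      unfolding norm_mult norm_power using u by (intro summable_mult summable_geometric) auto
    ultimately show ?thesis
      unfolding eq u_def[symmetric] by (intro norm_summable_imp_has_sum) auto
  qed
  have lam': "lam < (1 - z) powr q"
    using lam z powr_mono2[of q "1 - \<bar>z\<bar>" "1 - z"] q abs_ge_self[of z] by linarith
  \<comment> \<open>For nonnegative terms, iterated summability gives joint summability. The terms
    are the absolute values of the signed series.\<close>
  have "(\<lambda>(m, t). f \<bar>z\<bar> lam m t) summable_on (UNIV \<times> UNIV)"
  proof (rule summable_on_SigmaI)
    show "((\<lambda>t. case (m, t) of (m, t) \<Rightarrow> f \<bar>z\<bar> lam m t) has_sum ((1 - \<bar>z\<bar>) powr (-(q * real m + 1)) * lam ^ m)) UNIV" for m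
      using row[of "\<bar>z\<bar>"] z by simp
    show "(\<lambda>m. (1 - \<bar>z\<bar>) powr (-(q * real m + 1)) * lam ^ m) summable_on UNIV"
      using geo[of "\<bar>z\<bar>" lam] lam z by (auto simp: summable_on_def)
  qed (use frac_h_nonneg q lam in \<open>auto simp: f_def\<close>)
  then have "(\<lambda>p. norm (case p of (m, t) \<Rightarrow> f z (-lam) m t)) summable_on (UNIV \<times> UNIV)"
    by (rule summable_on_cong[THEN iffD1, rotated])
      (use frac_h_nonneg q lam in \<open>auto simp: f_def abs_mult power_abs\<close>)
  then have summ: "(\<lambda>(m, t). f z (-lam) m t) summable_on (UNIV \<times> UNIV)"
    by (rule abs_summable_summable)
  have tot: "((\<lambda>(m, t). f z (-lam) m t) has_sum ((1 - z) powr q / ((1 - z) * ((1 - z) powr q + lam)))) (UNIV \<times> UNIV)"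
    by (rule has_sum_SigmaI[OF _ _ summ, where g="\<lambda>m. (1 - z) powr (-(q * real m + 1)) * (-lam) ^ m"])
      (use row[OF z] geo[OF z, of "-lam"] lam lam' in auto)
  have tot': "((\<lambda>(t, m). f z (-lam) m t) has_sum ((1 - z) powr q / ((1 - z) * ((1 - z) powr q + lam)))) (UNIV \<times> UNIV)"
    using tot by (subst has_sum_swap) (simp add: case_prod_unfold)
  have col: "(\<lambda>m. f z (-lam) m t) summable_on UNIV" for t
    using summable_on_SigmaD1[of "\<lambda>t m. f z (-lam) m t" UNIV "\<lambda>_. UNIV" t] tot'
    by (auto simp: summable_on_def)
  have "infsum (\<lambda>m. f z (-lam) m t) UNIV = discrete_mittag_leffler q (- lam) (real (Suc t)) * z ^ t" for t
  proof -
    have S: "(\<lambda>m. f z (-lam) m t) sums infsum (\<lambda>m. f z (-lam) m t) UNIV"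
      using col[of t] by (intro has_sum_imp_sums has_sum_infsum)
    show ?thesis
    \<comment> \<open>Cancelling \<open>z ^ t\<close> fails for \<open>z = 0\<close> and
      \<open>t > 0\<close>; there both sides are 0.\<close>
    proof (cases "z ^ t = 0")
      case True
      then show ?thesis
        unfolding f_def True by simp
    next
      case False
      have "(\<lambda>m. frac_h (q * real m) (real (Suc t)) * (-lam) ^ m) sums (infsum (\<lambda>m. f z (-lam) m t) UNIV / z ^ t)"
        using sums_divide[OF S, of "z ^ t"] False unfolding f_def by (simp only: nonzero_mult_div_cancel_right[OF False])
      then show ?thesis
        using False by (simp add: discrete_mittag_leffler_def sums_iff)
    qed
  qed
  with col have "((\<lambda>m. f z (-lam) m t) has_sum (discrete_mittag_leffler q (- lam) (real (Suc t)) * z ^ t)) UNIV" for t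
    by (metis has_sum_infsum)
  then have "((\<lambda>t. discrete_mittag_leffler q (- lam) (real (Suc t)) * z ^ t)
      has_sum ((1 - z) powr q / ((1 - z) * ((1 - z) powr q + lam)))) UNIV"
    by (intro has_sum_SigmaD[OF tot']) simp
  then show ?thesis
    by (rule has_sum_imp_sums)
qed

text \<open>The tail at \<open>t = 0\<close> is 1 by almost sure positivity, and the Mittag-Leffler
  formula gives the tails from \<open>t = 1\<close> on. So the tail series is 1 plus
  \<open>z\<close> times the shifted series, and \<open>pgf_tail_sums\<close> is solved for the
  PGF.\<close>

lemma (in prob_space) pgf_mittag_leffler_near_0:
  assumes X: "mittag_leffler_distributed M q lam X"
    and q: "0 < q" and lam: "0 < lam" "lam < (1 - \<bar>z\<bar>) powr q" and z: "\<bar>z\<bar> < 1"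
  shows "pgf M X z = lam * z / ((1 - z) powr q + lam)"
proof -
  define u where "u = (1 - z) powr q"
  have u: "u > 0"
    using z by (simp add: u_def)
  have [measurable]: "X \<in> measurable M (count_space UNIV)"
    and ae: "AE \<omega> in M. 1 \<le> X \<omega>"
    and P: "\<And>t. t \<ge> 1 \<Longrightarrow> prob {\<omega> \<in> space M. t < X \<omega>} = discrete_mittag_leffler q (- lam) (real t)"
    using X by (auto simp: mittag_leffler_distributed_def)
  have "prob {\<omega> \<in> space M. 0 < X \<omega>} = 1"
    by (rule prob_Collect_eq_1[THEN iffD2]) (use ae in auto)
  moreover have "(\<lambda>t. prob {\<omega> \<in> space M. Suc t < X \<omega>} * z ^ Suc t) sums (z * (u / ((1 - z) * (u + lam))))"
    using sums_mult[OF discrete_mittag_leffler_sums[OF q lam z], of z] by (simp add: P mult_ac u_def)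
  ultimately have "(\<lambda>t. prob {\<omega> \<in> space M. t < X \<omega>} * z ^ t) sums (z * (u / ((1 - z) * (u + lam))) + 1)"
    by (subst (asm) sums_Suc_iff) simp
  then have "(1 - pgf M X z) / (1 - z) = z * (u / ((1 - z) * (u + lam))) + 1"
    using pgf_tail_sums[of X z] z by (auto dest: sums_unique2)
  then have "1 - pgf M X z = (1 - z) * (z * (u / ((1 - z) * (u + lam))) + 1)"
    using z by (simp add: field_simps)
  also have "\<dots> = z * u / (u + lam) + (1 - z)"
  proof -
    have "1 - z \<noteq> 0"
      using z by auto
    then have "(1 - z) * (z * (u / ((1 - z) * (u + lam)))) = z * u / (u + lam)"
      by simp
    then show ?thesis
      by (simp add: distrib_left)
  qed
  finally show ?thesis
    using u lam by (simp add: u_def[symmetric] field_simps)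
qed

text \<open>Near \<open>0\<close> the power series \<open>G(z) (1 - z)\<^sup>q + \<lambda> G(z) - \<lambda> z\<close> vanishes, so its coefficients do;
  it converges on the whole open disc, which carries the formula for \<open>G\<close> there.\<close>

lemma pgf_mittag_leffler:
  assumes M: "prob_space M" and X: "mittag_leffler_distributed M q lam X"
    and q: "0 < q" and lam: "0 < lam" "lam < 1" and z: "\<bar>z\<bar> \<le> 1"
  shows "pgf M X z = lam * z / ((1 - z) powr q + lam)"
proof -
  interpret prob_space M by fact
  have [measurable]: "X \<in> measurable M (count_space UNIV)"
    using X by (auto simp: mittag_leffler_distributed_def)
  define p where "p k = prob {\<omega> \<in> space M. X \<omega> = k}" for k
  define b where "b k = (-1) ^ k * (q gchoose k)" for k
  define c where "c k = (\<Sum>i\<le>k. p i * b (k - i)) + lam * p k - (if k = 1 then lam else 0)" for k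
  have pz: "(\<lambda>k. p k * z ^ k) sums pgf M X z" if "\<bar>z\<bar> < 1" for z
    using pgf_sums[of X z] that by (simp add: p_def)
  have bz: "(\<lambda>k. b k * z ^ k) sums (1 - z) powr q" if "\<bar>z\<bar> < 1" for z
    using one_minus_powr_sums[OF that] by (simp add: b_def)
  have cz: "(\<lambda>k. c k * z ^ k) sums (pgf M X z * (1 - z) powr q + lam * pgf M X z - lam * z)"
    if z: "\<bar>z\<bar> < 1" for z
  proof -
    have "(\<lambda>k. \<Sum>i\<le>k. (p i * z ^ i) * (b (k - i) * z ^ (k - i))) sums
        ((\<Sum>k. p k * z ^ k) * (\<Sum>k. b k * z ^ k))"
      by (intro Cauchy_product_sums summable_norm_sums_unit_disc[OF pz] summable_norm_sums_unit_disc[OF bz] z)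
    also have "(\<lambda>k. \<Sum>i\<le>k. (p i * z ^ i) * (b (k - i) * z ^ (k - i))) = (\<lambda>k. (\<Sum>i\<le>k. p i * b (k - i)) * z ^ k)"
    proof
      fix k
      have e: "p i * z ^ i * (b (k - i) * z ^ (k - i)) = p i * b (k - i) * z ^ k" if "i \<le> k" for i
        using power_add[of z i "k - i"] that by (simp add: mult_ac)
      show "(\<Sum>i\<le>k. (p i * z ^ i) * (b (k - i) * z ^ (k - i))) = (\<Sum>i\<le>k. p i * b (k - i)) * z ^ k"
        unfolding sum_distrib_right by (rule sum.cong[OF refl e]) simp
    qed
    finally have 1: "(\<lambda>k. (\<Sum>i\<le>k. p i * b (k - i)) * z ^ k) sums (pgf M X z * (1 - z) powr q)"
      using pz[OF z] bz[OF z] by (simp add: sums_iff)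
    have 2: "(\<lambda>k. (if k = 1 then lam * z ^ k else 0)) sums (lam * z)"
      using sums_single[of 1 "\<lambda>k. lam * z ^ k"] by simp
    show ?thesis
      using sums_diff[OF sums_add[OF 1 sums_mult[OF pz[OF z], of lam]] 2]
      by (rule sums_cong[THEN iffD1, rotated]) (auto simp: c_def algebra_simps)
  qed
  have denom: "(1 - w) powr q + lam > 0" for w
    using lam powr_ge_zero[of "1 - w" q] by linarith
  \<comment> \<open>Chosen so that \<open>(1 - s) powr q = lam\<close>; hence \<open>|x| < s\<close>
    gives the hypothesis of \<open>pgf_mittag_leffler_near_0\<close>.\<close>
  define s where "s = 1 - lam powr (1 / q)"
  have s: "0 < s" "s < 1"
    using lam q by (auto simp: s_def powr01_less_one)
  have "c k = 0" for k
  proof (rule powser_eq_0_near_0_imp_coeff_eq_0[OF s(1)])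
    fix x :: real assume x: "norm x < s"
    then have "(lam powr (1 / q)) powr q < (1 - \<bar>x\<bar>) powr q"
      using lam q by (intro powr_less_mono2) (auto simp: s_def)
    then have "lam < (1 - \<bar>x\<bar>) powr q"
      using lam q by (simp add: powr_powr)
    then have "pgf M X x = lam * x / ((1 - x) powr q + lam)"
      using x s by (intro pgf_mittag_leffler_near_0 X q lam) auto
    then have "pgf M X x * (1 - x) powr q + lam * pgf M X x - lam * x = 0"
      using denom[of x] by (simp add: field_simps)
    then show "(\<lambda>k. c k * x ^ k) sums 0"
      using cz[of x] x s by simp
  qed
  then have int: "pgf M X z = lam * z / ((1 - z) powr q + lam)" if "\<bar>z\<bar> < 1" for z
    using cz[OF that] denom[of z] by (simp add: sums_iff field_simps)
  have "continuous_on {-1..1} (\<lambda>z. lam * z / ((1 - z) powr q + lam))"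
    using denom by (intro continuous_intros continuous_on_one_minus_powr q) (simp add: less_imp_neq[symmetric])
  then show ?thesis
    by (intro pgf_eqI_interior[OF _ _ int z]) auto
qed

section \<open>The subordinated process\<close>

lemma le_sum_of_positive:
  fixes x :: "nat \<Rightarrow> nat"
  assumes "\<forall>i\<ge>1. 1 \<le> x i"
  shows "n \<le> (\<Sum>i = 1..n. x i)"
  using sum_mono[of "{1..n}" "\<lambda>_. 1" x] assms by simp

text \<open>Positive steps bound the index set by \<open>t\<close>, so \<open>Max\<close> ranges
  over a finite set; partial sums increase, so that set is an initial segment.\<close>

lemma renewal_count_ge_iff:
  assumes pos: "\<forall>i\<ge>1. 1 \<le> T i \<omega>"
  shows "n \<le> renewal_count T t \<omega> \<longleftrightarrow> (\<Sum>i = 1..n. T i \<omega>) \<le> t"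
proof -
  let ?A = "{n. (\<Sum>i = 1..n. T i \<omega>) \<le> t}"
  have "?A \<subseteq> {..t}"
    using le_sum_of_positive[OF pos] by (auto intro: order_trans)
  then have "finite ?A"
    by (rule finite_subset) simp
  moreover have "0 \<in> ?A" by simp
  ultimately have "n \<le> renewal_count T t \<omega> \<longleftrightarrow> (\<exists>k\<in>?A. n \<le> k)"
    unfolding renewal_count_def by (subst Max_ge_iff) blast+
  also have "\<dots> \<longleftrightarrow> n \<in> ?A"
  proof
    assume "\<exists>k\<in>?A. n \<le> k"
    then obtain k where k: "(\<Sum>i = 1..k. T i \<omega>) \<le> t" "n \<le> k" by auto
    then have "(\<Sum>i = 1..n. T i \<omega>) \<le> (\<Sum>i = 1..k. T i \<omega>)"
      by (intro sum_mono2) auto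
    with k show "n \<in> ?A" by simp
  qed auto
  finally show ?thesis by simp
qed

lemma subordinated_count_ge_iff:
  assumes "\<forall>i\<ge>1. 1 \<le> T i \<omega>" "\<forall>i\<ge>1. 1 \<le> X i \<omega>"
  shows "n \<le> subordinated_count T X t \<omega> \<longleftrightarrow> (\<Sum>j = 1..(\<Sum>i = 1..n. T i \<omega>). X j \<omega>) \<le> t"
  unfolding subordinated_count_def renewal_count_ge_iff[of T \<omega>, OF assms(1)]
    renewal_count_ge_iff[of X \<omega>, OF assms(2)] ..

lemma arrival_time_subordinated_count:
  assumes "\<forall>i\<ge>1. 1 \<le> T i \<omega>" "\<forall>i\<ge>1. 1 \<le> X i \<omega>"
  shows "arrival_time (subordinated_count T X) n \<omega> = (\<Sum>j = 1..(\<Sum>i = 1..n. T i \<omega>). X j \<omega>)"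
  unfolding arrival_time_def subordinated_count_ge_iff[of T \<omega> X, OF assms]
  by (rule Least_equality) auto

text \<open>Consecutive arrivals are the walk \<open>X\<close> at \<open>s\<close> and at
  \<open>s + T n\<close>. The later one is the earlier one plus a block of steps, so the truncated
  subtraction loses nothing.\<close>

lemma waiting_time_subordinated_count:
  assumes pos: "\<forall>i\<ge>1. 1 \<le> T i \<omega>" "\<forall>i\<ge>1. 1 \<le> X i \<omega>" and n: "n \<ge> 1"
  defines "s \<equiv> \<Sum>i = 1..n - 1. T i \<omega>"
  shows "waiting_time (subordinated_count T X) n \<omega> = (\<Sum>j = s + 1..s + T n \<omega>. X j \<omega>)"
proof -
  have A: "(\<Sum>i = 1..n. T i \<omega>) = s + T n \<omega>"
    using n by (cases n) (auto simp: s_def)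
  have B: "(\<Sum>j = 1..s + T n \<omega>. X j \<omega>) = (\<Sum>j = 1..s. X j \<omega>) + (\<Sum>j = s + 1..s + T n \<omega>. X j \<omega>)"
    by (rule sum.ub_add_nat) simp
  show ?thesis
    unfolding waiting_time_def arrival_time_subordinated_count[of T \<omega> X, OF pos] s_def[symmetric] A B
    by (rule add_diff_cancel_left')
qed

section \<open>Measurability of counts and waiting times\<close>

lemma measurable_renewal_count:
  assumes [measurable]: "\<And>i. i \<ge> 1 \<Longrightarrow> T i \<in> measurable M (count_space UNIV)"
  shows "renewal_count T t \<in> measurable M (count_space UNIV)"
proof -
  have [measurable]: "(\<lambda>\<omega>. \<Sum>i = 1..n. T i \<omega>) \<in> measurable M (count_space UNIV)" for n
    by (rule measurable_sum_nat) (use assms in auto)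
  show ?thesis
    unfolding renewal_count_def[abs_def] by measurable
qed

lemma measurable_subordinated_count:
  assumes "\<And>i. i \<ge> 1 \<Longrightarrow> T i \<in> measurable M (count_space UNIV)"
    and "\<And>i. i \<ge> 1 \<Longrightarrow> X i \<in> measurable M (count_space UNIV)"
  shows "subordinated_count T X t \<in> measurable M (count_space UNIV)"
  unfolding subordinated_count_def[abs_def]
  by (rule measurable_compose_countable[OF measurable_renewal_count measurable_renewal_count]) (use assms in auto)

lemma measurable_waiting_time:
  assumes [measurable]: "\<And>t. N t \<in> measurable M (count_space UNIV)"
  shows "waiting_time N n \<in> measurable M (count_space UNIV)"
  unfolding waiting_time_def[abs_def] arrival_time_def by measurable

lemma measurable_nat_binop:
  fixes f g :: "'a \<Rightarrow> nat" and h :: "nat \<Rightarrow> nat \<Rightarrow> 'b"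
  assumes f: "f \<in> measurable M (count_space UNIV)" and g: "g \<in> measurable M (count_space UNIV)"
  shows "(\<lambda>x. h (f x) (g x)) \<in> measurable M (count_space UNIV)"
  by (rule measurable_compose_countable[where f="\<lambda>i x. h i (g x)", OF measurable_compose[OF g] f]) simp

section \<open>Conditioning on the standard process\<close>

locale subordination =
  fixes M :: "'a measure" and q lam :: real and T X :: "nat \<Rightarrow> 'a \<Rightarrow> nat"
  assumes model: "subordination_model M q lam T X"

sublocale subordination \<subseteq> prob_space M
  using model by (simp add: subordination_model_def)

context subordination
begin

lemma T_distributed: "i \<ge> 1 \<Longrightarrow> mittag_leffler_distributed M 1 lam (T i)"
  and X_distributed: "i \<ge> 1 \<Longrightarrow> sibuya_distributed M q (X i)"
  and indep: "indep_vars (\<lambda>_. count_space UNIV) (case_sum T X) ({1..} <+> {1..})"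
  using model by (auto simp: subordination_model_def)

lemma measurable_T: "i \<ge> 1 \<Longrightarrow> T i \<in> measurable M (count_space UNIV)"
  and measurable_X: "i \<ge> 1 \<Longrightarrow> X i \<in> measurable M (count_space UNIV)"
  using T_distributed X_distributed
  by (auto simp: mittag_leffler_distributed_def sibuya_distributed_def)

lemma AE_T_pos: "AE \<omega> in M. \<forall>i\<ge>1. 1 \<le> T i \<omega>"
  and AE_X_pos: "AE \<omega> in M. \<forall>i\<ge>1. 1 \<le> X i \<omega>"
  using T_distributed X_distributed
  by (auto simp: mittag_leffler_distributed_def sibuya_distributed_def AE_all_countable)

lemma measurable_W: "waiting_time (subordinated_count T X) n \<in> measurable M (count_space UNIV)"
  by (intro measurable_waiting_time measurable_subordinated_count measurable_T measurable_X)

lemma pgf_X: "i \<ge> 1 \<Longrightarrow> 0 < q \<Longrightarrow> \<bar>z\<bar> \<le> 1 \<Longrightarrow> pgf M (X i) z = 1 - (1 - z) powr q"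
  by (rule sibuya_pgf[OF prob_space_axioms X_distributed])

text \<open>Independence factors the expectation into \<open>b\<close> equal Sibuya PGFs, wherever
  the block starts.\<close>

lemma expectation_power_sum_X:
  assumes q: "0 < q" and z: "\<bar>z\<bar> \<le> 1"
  shows "(\<integral>\<omega>. z ^ (\<Sum>j = a + 1..a + b. X j \<omega>) \<partial>M) = (1 - (1 - z) powr q) ^ b"
proof -
  let ?J = "Inr ` {a + 1..a + b} :: (nat + nat) set"
  have "indep_vars (\<lambda>_. borel) (\<lambda>j \<omega>. z ^ case_sum T X j \<omega>) ?J"
    by (rule indep_vars_compose2[where Y="\<lambda>_ n. z ^ n", OF indep_vars_subset[OF indep]]) auto
  moreover have "integrable M (\<lambda>\<omega>. z ^ case_sum T X j \<omega>)" if "j \<in> ?J" for j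
  proof (rule integrable_const_bound[where B=1])
    show "AE \<omega> in M. norm (z ^ case_sum T X j \<omega>) \<le> 1"
      using abs_power_le_1[OF z] by simp
    have "case_sum T X j \<in> measurable M (count_space UNIV)"
      using that measurable_X by auto
    then show "(\<lambda>\<omega>. z ^ case_sum T X j \<omega>) \<in> borel_measurable M"
      by (rule measurable_compose) simp
  qed
  ultimately have "(\<integral>\<omega>. (\<Prod>j\<in>?J. z ^ case_sum T X j \<omega>) \<partial>M) = (\<Prod>j\<in>?J. \<integral>\<omega>. z ^ case_sum T X j \<omega> \<partial>M)"
    by (intro indep_vars_lebesgue_integral) auto
  then have "(\<integral>\<omega>. (\<Prod>j = a + 1..a + b. z ^ X j \<omega>) \<partial>M) = (\<Prod>j = a + 1..a + b. pgf M (X j) z)"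
    by (simp add: prod.reindex pgf_def)
  also have "\<dots> = (\<Prod>j = a + 1..a + b. 1 - (1 - z) powr q)"
    by (intro prod.cong refl pgf_X q z) auto
  finally show ?thesis
    by (simp add: power_sum)
qed

text \<open>Conditioning on the pair \<open>(S\<^sub>n\<^sub>-\<^sub>1, T\<^sub>n)\<close>, coded as one natural number: it is independent of the walk
  \<open>X\<close>, and given its value \<open>W\<^sub>n\<close> is a sum of exactly \<open>T\<^sub>n\<close> independent steps.\<close>

lemma pgf_W:
  assumes q: "0 < q" and z: "\<bar>z\<bar> \<le> 1" and n: "n \<ge> 1"
  shows "pgf M (waiting_time (subordinated_count T X) n) z = pgf M (T n) (1 - (1 - z) powr q)"
proof -
  let ?W = "waiting_time (subordinated_count T X) n"
  define S where "S = 1 - (1 - z) powr q"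
  \<comment> \<open>\<open>S\<close> is itself a value of a Sibuya PGF, hence in [-1, 1] for
    negative \<open>z\<close> as well; this keeps \<open>S ^ T n\<close> bounded.\<close>
  have S: "\<bar>S\<bar> \<le> 1"
    using abs_pgf_le_1[OF measurable_X z, of 1] pgf_X[OF _ q z, of 1] by (simp add: S_def)
  have [measurable]: "\<And>i. i \<ge> 1 \<Longrightarrow> T i \<in> measurable M (count_space UNIV)"
     "\<And>i. i \<ge> 1 \<Longrightarrow> X i \<in> measurable M (count_space UNIV)"
    using measurable_T measurable_X by auto
  have Tn [measurable]: "T n \<in> measurable M (count_space UNIV)"
    using n measurable_T by auto
  define Y where "Y \<omega> = prod_encode (\<Sum>i = 1..n - 1. T i \<omega>, T n \<omega>)" for \<omega>
  \<comment> \<open>\<open>Y\<close> as a function of the \<open>Inl\<close> coordinates alone, so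
    that independence of the two coordinate blocks applies to it.\<close>
  define yt where "yt v = prod_encode (\<Sum>i = 1..n - 1. v (Inl i), v (Inl n))" for v :: "nat + nat \<Rightarrow> nat"
  have comp: "(\<lambda>v. v i) \<in> measurable (PiM I (\<lambda>_. count_space UNIV)) (count_space UNIV)" if "i \<in> I"
    for i and I :: "(nat + nat) set"
    using that by (rule measurable_component_singleton)
  have yt: "yt \<in> measurable (PiM (Inl ` {1..}) (\<lambda>_. count_space UNIV)) (count_space UNIV)"
    unfolding yt_def[abs_def]
    by (rule measurable_nat_binop[where h="\<lambda>x y. prod_encode (x, y)", OF measurable_sum_nat[OF comp] comp]) (use n in auto)
  have Y: "Y \<omega> = yt (restrict (\<lambda>i. case_sum T X i \<omega>) (Inl ` {1..}))" for \<omega>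
    using n by (auto simp: Y_def yt_def intro!: sum.cong)
  have Ym [measurable]: "Y \<in> measurable M (count_space UNIV)"
    unfolding Y_def[abs_def]
    by (rule measurable_nat_binop[where h="\<lambda>x y. prod_encode (x, y)", OF measurable_sum_nat Tn]) auto
  have indep2: "indep_var (PiM (Inl ` {1..}) (\<lambda>_. count_space UNIV)) (\<lambda>\<omega>. restrict (\<lambda>i. case_sum T X i \<omega>) (Inl ` {1..}))
     (PiM (Inr ` {1..}) (\<lambda>_. count_space UNIV)) (\<lambda>\<omega>. restrict (\<lambda>i. case_sum T X i \<omega>) (Inr ` {1..}))"
    by (rule indep_var_restrict[OF indep]) auto
  \<comment> \<open>On \<open>Y = c\<close> the waiting time is almost surely a fixed block of
    \<open>b\<close> steps, independent of that event. Its factor averages to \<open>S ^ b\<close>,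
    which is \<open>S ^ T n\<close> there.\<close>
  have cond: "(\<integral>\<omega>. indicator {\<omega>\<in>space M. Y \<omega> = c} \<omega> * z ^ ?W \<omega> \<partial>M)
      = (\<integral>\<omega>. indicator {\<omega>\<in>space M. Y \<omega> = c} \<omega> * S ^ T n \<omega> \<partial>M)" for c
  proof -
    obtain a b where c: "c = prod_encode (a, b)"
      by (metis prod_decode_inverse surj_pair)
    have Yc: "(\<Sum>i = 1..n - 1. T i \<omega>) = a \<and> T n \<omega> = b" if "Y \<omega> = c" for \<omega>
      using that by (simp add: Y_def c)
    define g where "g v = z ^ (\<Sum>j = a + 1..a + b. v (Inr j))" for v :: "nat + nat \<Rightarrow> nat"
    have g: "g \<in> borel_measurable (PiM (Inr ` {1..}) (\<lambda>_. count_space UNIV))"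
      unfolding g_def by (intro measurable_compose[OF measurable_sum_nat] comp) auto
    have gX: "g (restrict (\<lambda>i. case_sum T X i \<omega>) (Inr ` {1..})) = z ^ (\<Sum>j = a + 1..a + b. X j \<omega>)" for \<omega>
      by (auto simp: g_def intro!: arg_cong[where f="power z"] sum.cong)
    have XX [measurable]: "(\<lambda>\<omega>. \<Sum>j = a + 1..a + b. X j \<omega>) \<in> measurable M (count_space UNIV)"
      by (rule measurable_sum_nat) (use measurable_X in auto)
    have "indep_var borel ((\<lambda>v. indicator {c} (yt v) :: real) \<circ> (\<lambda>\<omega>. restrict (\<lambda>i. case_sum T X i \<omega>) (Inl ` {1..})))
        borel (g \<circ> (\<lambda>\<omega>. restrict (\<lambda>i. case_sum T X i \<omega>) (Inr ` {1..})))"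
      by (rule indep_var_compose[OF indep2 measurable_compose[OF yt] g]) simp
    then have "indep_var borel (\<lambda>\<omega>. indicator {c} (Y \<omega>) :: real) borel (\<lambda>\<omega>. z ^ (\<Sum>j = a + 1..a + b. X j \<omega>))"
      by (simp only: comp_def Y gX)
    then have "(\<integral>\<omega>. indicator {c} (Y \<omega>) * z ^ (\<Sum>j = a + 1..a + b. X j \<omega>) \<partial>M)
      = (\<integral>\<omega>. indicator {c} (Y \<omega>) \<partial>M) * S ^ b"
    proof (subst indep_var_lebesgue_integral)
      have [measurable]: "(\<lambda>\<omega>. indicator {c} (Y \<omega>) :: real) \<in> borel_measurable M"
        by (rule measurable_compose[OF Ym]) simp
      show "integrable M (\<lambda>\<omega>. indicator {c} (Y \<omega>) :: real)"
        by (rule integrable_const_bound[where B=1]) auto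
      show "integrable M (\<lambda>\<omega>. z ^ (\<Sum>j = a + 1..a + b. X j \<omega>))"
        using abs_power_le_1[OF z] by (intro integrable_const_bound[where B=1]) auto
    qed (simp_all only: expectation_power_sum_X[OF q z] S_def)
    \<comment> \<open>The block form of the waiting time needs positive steps, so the integrands
      agree only almost everywhere.\<close>
    moreover have "(\<integral>\<omega>. indicator {\<omega>\<in>space M. Y \<omega> = c} \<omega> * z ^ ?W \<omega> \<partial>M)
      = (\<integral>\<omega>. indicator {c} (Y \<omega>) * z ^ (\<Sum>j = a + 1..a + b. X j \<omega>) \<partial>M)"
    proof (rule integral_cong_AE)
      show "AE \<omega> in M. indicator {\<omega>\<in>space M. Y \<omega> = c} \<omega> * z ^ ?W \<omega>
          = indicator {c} (Y \<omega>) * z ^ (\<Sum>j = a + 1..a + b. X j \<omega>)"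
        using AE_T_pos AE_X_pos AE_space
      proof eventually_elim
        case (elim \<omega>)
        show ?case
        proof (cases "Y \<omega> = c")
          case True
          have "?W \<omega> = (\<Sum>j = a + 1..a + b. X j \<omega>)"
            using waiting_time_subordinated_count[of T \<omega> X, OF elim(1,2) n] Yc[OF True] by simp
          with True elim(3) show ?thesis
            by simp
        qed simp
      qed
    next
      show "(\<lambda>\<omega>. indicator {\<omega>\<in>space M. Y \<omega> = c} \<omega> * z ^ ?W \<omega>) \<in> borel_measurable M"
        using measurable_W[of n] by measurable
      show "(\<lambda>\<omega>. indicator {c} (Y \<omega>) * z ^ (\<Sum>j = a + 1..a + b. X j \<omega>)) \<in> borel_measurable M"
        by (intro borel_measurable_times measurable_compose[OF Ym] measurable_compose[OF XX]) auto
    qed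
    moreover have "(\<integral>\<omega>. indicator {\<omega>\<in>space M. Y \<omega> = c} \<omega> * S ^ T n \<omega> \<partial>M)
      = (\<integral>\<omega>. indicator {c} (Y \<omega>) * S ^ b \<partial>M)"
      by (rule Bochner_Integration.integral_cong) (use Yc in \<open>auto split: split_indicator\<close>)
    ultimately show ?thesis
      by simp
  qed
  have "(\<lambda>c. \<integral>\<omega>. indicator {\<omega>\<in>space M. Y \<omega> = c} \<omega> * z ^ ?W \<omega> \<partial>M) sums pgf M ?W z"
    unfolding pgf_def using measurable_W by (intro expectation_sums_over_value abs_power_le_1 z) auto
  moreover have "(\<lambda>c. \<integral>\<omega>. indicator {\<omega>\<in>space M. Y \<omega> = c} \<omega> * S ^ T n \<omega> \<partial>M) sums pgf M (T n) S"
    unfolding pgf_def by (intro expectation_sums_over_value abs_power_le_1 S) auto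
  ultimately show ?thesis
    unfolding cond S_def[symmetric] by (rule sums_unique2)
qed

end

section \<open>Comparison of the two models\<close>

text \<open>If the mean were a finite \<open>E\<close>, Bernoulli's inequality would give
  \<open>1 - G(1 - w) \<le> E * w\<close> for the PGF \<open>G\<close>. With the assumed lower
  bound, \<open>c \<le> w powr (1 - q) * E\<close> for all small \<open>w\<close>, which fails as
  \<open>w\<close> tends to 0.\<close>

lemma (in prob_space) infinite_mean_of_pgf:
  assumes X [measurable]: "X \<in> measurable M (count_space UNIV)"
    and q: "q < 1" and c: "0 < c"
    and le: "\<And>z. 0 \<le> z \<Longrightarrow> z < 1 \<Longrightarrow> c * (1 - z) powr q \<le> 1 - pgf M X z"
  shows "(\<integral>\<^sup>+ \<omega>. ennreal (real (X \<omega>)) \<partial>M) = \<infinity>"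
proof (rule ccontr)
  assume "(\<integral>\<^sup>+ \<omega>. ennreal (real (X \<omega>)) \<partial>M) \<noteq> \<infinity>"
  then have int: "integrable M (\<lambda>\<omega>. real (X \<omega>))"
    by (intro integrableI_nonneg) (auto simp: top.not_eq_extremum)
  define E where "E = (\<integral>\<omega>. real (X \<omega>) \<partial>M)"
  have E: "0 \<le> E"
    unfolding E_def by simp
  \<comment> \<open>Solves \<open>w powr (1 - q) = c / (2 * (E + c))\<close>, which is at most 1/2
    and gives \<open>w powr (1 - q) * E < c\<close>; adding \<open>c\<close> to \<open>E\<close>
    covers \<open>E = 0\<close>.\<close>
  define w where "w = (c / (2 * (E + c))) powr (1 / (1 - q))"
  have frac: "0 < c / (2 * (E + c))" "c / (2 * (E + c)) < 1"
    using E c by (auto simp: field_simps)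
  have w: "0 < w" "w < 1" "w powr (1 - q) = c / (2 * (E + c))"
    using frac q E c by (auto simp: w_def powr_powr powr01_less_one)
  have z: "\<bar>1 - w\<bar> \<le> 1" using w by auto
  have intz: "integrable M (\<lambda>\<omega>. (1 - w) ^ X \<omega>)"
    by (rule integrable_const_bound[where B=1]) (use abs_power_le_1[OF z] in auto)
  have "c * w powr q \<le> 1 - pgf M X (1 - w)"
    using le[of "1 - w"] w by simp
  also have "\<dots> = (\<integral>\<omega>. 1 - (1 - w) ^ X \<omega> \<partial>M)"
    using intz by (simp add: pgf_def prob_space)
  also have "\<dots> \<le> (\<integral>\<omega>. real (X \<omega>) * w \<partial>M)"
  proof (rule integral_mono)
    fix \<omega>
    show "1 - (1 - w) ^ X \<omega> \<le> real (X \<omega>) * w"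
      using Bernoulli_inequality[of "- w" "X \<omega>"] w by simp
  qed (use int intz in auto)
  also have "\<dots> = w powr (1 - q) * E * w powr q"
    using w(1) by (simp add: E_def mult_ac flip: powr_add)
  finally have "c \<le> w powr (1 - q) * E"
    using w(1) by simp
  also have "\<dots> < c"
    using E c by (simp add: w(3) field_simps add_nonneg_pos)
  finally show False by simp
qed

text \<open>Powers of a positive base other than 1 are injective in the exponent. At
  \<open>u = 1 - z\<close> this separates the two numerators.\<close>

lemma powr_neq_self:
  fixes u q :: real
  assumes "0 < u" "u \<noteq> 1" "q \<noteq> 1"
  shows "u powr q \<noteq> u"
  using assms powr_inj[of u q 1] by simp

text \<open>The PGF depends only on the law, so a difference at one point separates laws, even
  across probability spaces.\<close>

lemma pgf_distr:
  assumes "X \<in> measurable M (count_space UNIV)"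
  shows "pgf M X z = (\<integral>k. z ^ k \<partial>distr M (count_space UNIV) X)"
  unfolding pgf_def by (rule integral_distr[symmetric, OF assms]) simp

text \<open>The counting process determines the law of the first arrival: \<open>N(t) = 0\<close> exactly when it exceeds \<open>t\<close>.\<close>

lemma pgf_first_arrival_eq:
  assumes M: "prob_space M" and M': "prob_space M'"
    and T: "T \<in> measurable M (count_space UNIV)" and W: "W \<in> measurable M' (count_space UNIV)"
    and N: "\<And>t. N t \<in> measurable M (count_space UNIV)" and N': "\<And>t. N' t \<in> measurable M' (count_space UNIV)"
    and iff: "\<And>t. AE \<omega> in M. t < T \<omega> \<longleftrightarrow> N t \<omega> = (0::nat)"
    and iff': "\<And>t. AE \<omega> in M'. t < W \<omega> \<longleftrightarrow> N' t \<omega> = (0::nat)"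
    and eq: "\<And>t. distr M (count_space UNIV) (N t) = distr M' (count_space UNIV) (N' t)"
    and z: "\<bar>z\<bar> < 1"
  shows "pgf M T z = pgf M' W z"
proof -
  interpret M: prob_space M by fact
  interpret M': prob_space M' by fact
  have tail: "M.prob {\<omega> \<in> space M. t < T \<omega>} = M'.prob {\<omega> \<in> space M'. t < W \<omega>}" for t
  proof -
    have "M.prob {\<omega> \<in> space M. t < T \<omega>} = M.prob (N t -` {0} \<inter> space M)"
      using T N[of t] iff[of t] by (intro M.finite_measure_eq_AE) auto
    also have "\<dots> = measure (distr M (count_space UNIV) (N t)) {0}"
      using N[of t] by (simp add: measure_distr)
    also have "\<dots> = M'.prob (N' t -` {0} \<inter> space M')"
      using N'[of t] by (simp add: measure_distr eq)
    also have "\<dots> = M'.prob {\<omega> \<in> space M'. t < W \<omega>}"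
      using W N'[of t] iff'[of t] by (intro M'.finite_measure_eq_AE) auto
    finally show ?thesis .
  qed
  have "(1 - pgf M T z) / (1 - z) = (1 - pgf M' W z) / (1 - z)"
    using M.pgf_tail_sums[OF T z] M'.pgf_tail_sums[OF W z] unfolding tail by (rule sums_unique2)
  with z show ?thesis by (auto simp: abs_less_iff)
qed

text \<open>Infinite means and differing laws are claimed for \<open>q < 1\<close>: at
  \<open>q = 1\<close> both waiting-time PGFs reduce to \<open>lam * z / (1 - z + lam)\<close>, a
  geometric law with finite mean.\<close>

theorem mainTheorem3:
  fixes M :: "'a measure" and T :: "nat \<Rightarrow> 'a \<Rightarrow> nat"
    and M' :: "'b measure" and T' X W :: "nat \<Rightarrow> 'b \<Rightarrow> nat"
    and q lam :: real
  assumes "0 < lam" "lam < 1" "0 < q" "q \<le> 1"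
    and renewal: "renewal_poisson_model M q lam T"
    and subord: "subordination_model M' q lam T' X"
  defines "W \<equiv> waiting_time (subordinated_count T' X)"
  shows
    "(\<forall>n\<ge>1. \<forall>z. \<bar>z\<bar> \<le> 1 \<longrightarrow>
        pgf M' (T' n) z = lam * z / (1 - z + lam) \<and>
        pgf M' (X n) z = 1 - (1 - z) powr q \<and>
        pgf M' (W n) z = pgf M' (T' n) (pgf M' (X n) z) \<and>
        pgf M' (W n) z = lam * (1 - (1 - z) powr q) / ((1 - z) powr q + lam) \<and>
        pgf M (T n) z = lam * z / ((1 - z) powr q + lam)) \<and>
     (q < 1 \<longrightarrow>
        (\<forall>n\<ge>1. (\<integral>\<^sup>+ \<omega>. ennreal (real (T n \<omega>)) \<partial>M) = \<infinity> \<and>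
                (\<integral>\<^sup>+ \<omega>. ennreal (real (W n \<omega>)) \<partial>M') = \<infinity>) \<and>
        (\<forall>z. \<bar>z\<bar> \<le> 1 \<and> z \<noteq> 0 \<and> z \<noteq> 1 \<longrightarrow> 1 - (1 - z) powr q \<noteq> z) \<and>
        (\<forall>n\<ge>1. distr M (count_space UNIV) (T n) \<noteq> distr M' (count_space UNIV) (W n)) \<and>
        (\<exists>t. distr M (count_space UNIV) (renewal_count T t)
               \<noteq> distr M' (count_space UNIV) (subordinated_count T' X t)))"
proof -
  note lam = \<open>0 < lam\<close> \<open>lam < 1\<close> and q = \<open>0 < q\<close> \<open>q \<le> 1\<close>
  interpret M: prob_space M
    using renewal by (simp add: renewal_poisson_model_def)
  interpret S: subordination M' q lam T' X
    using subord by unfold_locales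
  have T_distributed: "mittag_leffler_distributed M q lam (T n)" if "n \<ge> 1" for n
    using renewal that by (simp add: renewal_poisson_model_def)
  have T: "T n \<in> measurable M (count_space UNIV)" if "n \<ge> 1" for n
    using T_distributed[OF that] by (simp add: mittag_leffler_distributed_def)
  have T_pos: "AE \<omega> in M. \<forall>i\<ge>1. 1 \<le> T i \<omega>"
    using T_distributed by (auto simp: mittag_leffler_distributed_def AE_all_countable)
  have W: "W n \<in> measurable M' (count_space UNIV)" for n
    unfolding W_def by (rule S.measurable_W)
  have pgf_T: "pgf M (T n) z = lam * z / ((1 - z) powr q + lam)" if "n \<ge> 1" "\<bar>z\<bar> \<le> 1" for n z
    by (rule pgf_mittag_leffler[OF M.prob_space_axioms T_distributed[OF that(1)] q(1) lam that(2)])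
  have pgf_T': "pgf M' (T' n) z = lam * z / (1 - z + lam)" if "n \<ge> 1" "\<bar>z\<bar> \<le> 1" for n z
    using pgf_mittag_leffler[OF S.prob_space_axioms S.T_distributed[OF that(1)] _ lam that(2)] that(2)
    by simp
  have pgf_X: "pgf M' (X n) z = 1 - (1 - z) powr q" if "n \<ge> 1" "\<bar>z\<bar> \<le> 1" for n z
    by (rule S.pgf_X[OF that(1) q(1) that(2)])
  have pgf_W: "pgf M' (W n) z = pgf M' (T' n) (pgf M' (X n) z)" if "n \<ge> 1" "\<bar>z\<bar> \<le> 1" for n z
    unfolding W_def pgf_X[OF that] by (rule S.pgf_W[OF q(1) that(2,1)])
  have pgf_W': "pgf M' (W n) z = lam * (1 - (1 - z) powr q) / ((1 - z) powr q + lam)"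
    if "n \<ge> 1" "\<bar>z\<bar> \<le> 1" for n z
    unfolding pgf_W[OF that]
    \<comment> \<open>The inner PGF value lies in [-1, 1], so the formula for \<open>T'\<close>
      applies at it.\<close>
    using pgf_T'[OF that(1) S.abs_pgf_le_1[OF S.measurable_X[OF that(1)] that(2)]]
    by (simp add: pgf_X[OF that])
  have neq: "1 - (1 - z) powr q \<noteq> z" if "q < 1" "\<bar>z\<bar> \<le> 1" "z \<noteq> 0" "z \<noteq> 1" for z
    using powr_neq_self[of "1 - z" q] that by (auto simp: abs_le_iff)
  \<comment> \<open>At \<open>1/2\<close> the common denominator is positive, so only the numerators
    matter.\<close>
  have pgf_neq: "pgf M (T n) (1/2) \<noteq> pgf M' (W n) (1/2)" if "q < 1" "n \<ge> 1" for n
  proof -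
    have "(1/2::real) powr q + lam \<noteq> 0"
      using lam powr_ge_zero[of "1/2" q] by linarith
    moreover have "lam * (1/2) \<noteq> lam * (1 - (1/2) powr q)"
      using neq[OF that(1), of "1/2"] lam by simp
    ultimately have "lam * (1/2) / ((1/2) powr q + lam) \<noteq> lam * (1 - (1/2) powr q) / ((1/2) powr q + lam)"
      by (simp only: divide_cancel_right simp_thms)
    then show ?thesis
      using pgf_T[OF that(2), of "1/2"] pgf_W'[OF that(2), of "1/2"] by simp
  qed
  have mean: "(\<integral>\<^sup>+ \<omega>. ennreal (real (T n \<omega>)) \<partial>M) = \<infinity>" "(\<integral>\<^sup>+ \<omega>. ennreal (real (W n \<omega>)) \<partial>M') = \<infinity>"
    if "q < 1" "n \<ge> 1" for n
  proof -
    have u: "0 \<le> (1 - z) powr q" "(1 - z) powr q \<le> 1" if "0 \<le> z" "z < 1" for z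
      using that q powr_le1[of q "1 - z"] by auto
    show "(\<integral>\<^sup>+ \<omega>. ennreal (real (T n \<omega>)) \<partial>M) = \<infinity>"
    proof (rule M.infinite_mean_of_pgf[OF T[OF that(2)] that(1)])
      fix z :: real assume z: "0 \<le> z" "z < 1"
      define u where "u = (1 - z) powr q"
      have 1: "0 \<le> u" "u \<le> 1"
        using u[OF z] by (auto simp: u_def)
      have "1 - pgf M (T n) z = (u + lam * (1 - z)) / (u + lam)"
        using pgf_T[OF that(2), of z] z 1 lam by (simp add: u_def[symmetric] field_simps)
      \<comment> \<open>Dropping \<open>lam * (1 - z)\<close> and bounding \<open>u\<close> by 1
        below gives the constant \<open>1 / (1 + lam)\<close>.\<close>
      also have "\<dots> \<ge> u / (1 + lam)"
        using 1 z lam by (intro frac_le) auto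
      finally show "1 / (1 + lam) * (1 - z) powr q \<le> 1 - pgf M (T n) z"
        by (simp add: u_def)
    qed (use lam in simp)
    show "(\<integral>\<^sup>+ \<omega>. ennreal (real (W n \<omega>)) \<partial>M') = \<infinity>"
    proof (rule S.infinite_mean_of_pgf[OF W that(1)])
      fix z :: real assume z: "0 \<le> z" "z < 1"
      define u where "u = (1 - z) powr q"
      have 1: "0 \<le> u" "u \<le> 1"
        using u[OF z] by (auto simp: u_def)
      have "1 - pgf M' (W n) z = u * (1 + lam) / (u + lam)"
        using pgf_W'[OF that(2), of z] z 1 lam by (simp add: u_def[symmetric] field_simps)
      \<comment> \<open>Bounding \<open>u\<close> by 1 in the denominator lets
        \<open>1 + lam\<close> cancel, so the constant is 1.\<close>
      also have "\<dots> \<ge> u * (1 + lam) / (1 + lam)"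
        using 1 lam by (intro divide_left_mono) auto
      finally show "1 * (1 - z) powr q \<le> 1 - pgf M' (W n) z"
        using lam by (simp add: u_def)
    qed simp
  qed
  have distr_neq: "distr M (count_space UNIV) (T n) \<noteq> distr M' (count_space UNIV) (W n)"
    if "q < 1" "n \<ge> 1" for n
    using pgf_neq[OF that] pgf_distr[OF T[OF that(2)]] pgf_distr[OF W] by metis
  \<comment> \<open>Equal laws of the counts at every time would force equal PGFs of the first
    waiting times, against \<open>pgf_neq\<close>.\<close>
  have count_neq: "\<exists>t. distr M (count_space UNIV) (renewal_count T t)
      \<noteq> distr M' (count_space UNIV) (subordinated_count T' X t)" if "q < 1"
  proof (rule ccontr)
    assume "\<not> ?thesis"
    then have eq: "distr M (count_space UNIV) (renewal_count T t)
      = distr M' (count_space UNIV) (subordinated_count T' X t)" for t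
      by blast
    have iff: "AE \<omega> in M. t < T 1 \<omega> \<longleftrightarrow> renewal_count T t \<omega> = 0" for t
      using T_pos
    proof eventually_elim
      case (elim \<omega>)
      show ?case
        using renewal_count_ge_iff[of T \<omega> 1 t, OF elim] by auto
    qed
    have iff': "AE \<omega> in M'. t < W 1 \<omega> \<longleftrightarrow> subordinated_count T' X t \<omega> = 0" for t
      using S.AE_T_pos S.AE_X_pos
    proof eventually_elim
      case (elim \<omega>)
      \<comment> \<open>For \<open>n = 1\<close> the offset of the block is 0, so the first waiting
        time is also the first arrival.\<close>
      have "W 1 \<omega> = (\<Sum>j = 1..T' 1 \<omega>. X j \<omega>)"
        unfolding W_def using waiting_time_subordinated_count[of T' \<omega> X 1, OF elim] by simp
      then show ?case
        using subordinated_count_ge_iff[of T' \<omega> X 1 t, OF elim] by auto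
    qed
    have "pgf M (T 1) (1/2) = pgf M' (W 1) (1/2)"
      by (rule pgf_first_arrival_eq[OF M.prob_space_axioms S.prob_space_axioms T W _ _ iff iff' eq])
        (auto intro!: measurable_renewal_count measurable_subordinated_count T S.measurable_T S.measurable_X)
    then show False
      using pgf_neq[OF that, of 1] by simp
  qed
  show ?thesis
    using pgf_T' pgf_X pgf_W pgf_W' pgf_T mean neq distr_neq count_neq by auto
qed

end
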